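(* Let $E$ be a complete smooth finite-dimensional Riemannian manifold with geodesic distance $d$ and volume measure $dx$, and let $\mu(dx)=e^{-V(x)}\,dx$ be a probability measure on $E$ with $V\in C^3(E)$, such that the diffusion process on $E$ with generator $L=\frac12\,\mathrm{div}(\nabla)-\frac12\nabla V\cdot\nabla$ is non-explosive. Suppose there exist $\varepsilon>0$ and $x_0\in E$ with $\int_E e^{\varepsilon d^2(x,x_0)}\,\mu(dx)<+\infty$. Let $a>e^{3/2}$ and suppose there is a constant $D(a)$ such that (Var-Ent) holds: for all probability measures $\nu=h\,\mu$ with $H(\nu,\mu)\le1/2$, $$\int d^2(x,x_0)\,\mathbf 1_{\{h>a\}}\,d\nu\le D(a)\,H(\nu,\mu).$$ Then (Tronc) holds: there is a constant $c(a)$ such that for all probability measures $\nu=h\,\mu$ with $H(\nu,\mu)\le1/2$, $$W_2^2(\nu_a,\nu)\le c(a)\,H(\nu,\mu),\qquad\text{where } \nu_a=\frac{1}{\nu(h\le a)}\,h\,\mathbf 1_{\{h\le a\}}\,\mu .$$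
   Context: For probability measures $\nu,\nu'$ on $E$, $W_2(\nu,\nu')=\big(\inf_\pi\int_{E\times E}d^2(x,y)\,\pi(dx,dy)\big)^{1/2}$, where $\pi$ runs over all couplings of $(\nu,\nu')$, i.e. probability measures on $E\times E$ with marginals $\nu$ and $\nu'$. $H(\nu,\mu)=\int\log\frac{d\nu}{d\mu}\,d\nu$ if $\nu\ll\mu$ and $H(\nu,\mu)=+\infty$ otherwise. The notation $\nu=h\,\mu$ means that $\nu$ has density $h$ with respect to $\mu$. *)

theory Defs
  imports "HOL-Probability.Probability"
begin

section \<open>Maps of class C^k between normed spaces\<close>

text \<open>\<open>S\<close> is meant to be open: derivatives are taken at the points of \<open>S\<close>, not within \<open>S\<close>.
  In finite dimension, continuity of all iterated directional derivatives is the usual C^k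
  property.\<close>

fun Ck_on :: "nat \<Rightarrow> 'v::euclidean_space set \<Rightarrow> ('v \<Rightarrow> 'w::real_normed_vector) \<Rightarrow> bool" where
  "Ck_on 0 S f \<longleftrightarrow> continuous_on S f"
| "Ck_on (Suc k) S f \<longleftrightarrow>
     (\<forall>x\<in>S. f differentiable (at x)) \<and> (\<forall>v. Ck_on k S (\<lambda>x. frechet_derivative f (at x) v))"

definition smooth_on :: "'v::euclidean_space set \<Rightarrow> ('v \<Rightarrow> 'w::real_normed_vector) \<Rightarrow> bool" where
  "smooth_on S f \<longleftrightarrow> (\<forall>k. Ck_on k S f)"


section \<open>Charts and functions on a manifold\<close>

text \<open>A chart is a pair of its domain and its coordinate map; the values of the coordinate map
  outside the domain carry no meaning.  The manifold is the whole type \<open>'a\<close>.\<close>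

type_synonym ('a, 'n) chart = "'a set \<times> ('a \<Rightarrow> real^'n)"

abbreviation chart_dom :: "('a, 'n::finite) chart \<Rightarrow> 'a set" where
  "chart_dom c \<equiv> fst c"

abbreviation chart_map :: "('a, 'n::finite) chart \<Rightarrow> 'a \<Rightarrow> real^'n" where
  "chart_map c \<equiv> snd c"

definition chart_inv :: "('a, 'n::finite) chart \<Rightarrow> real^'n \<Rightarrow> 'a" where
  "chart_inv c = inv_into (chart_dom c) (chart_map c)"

definition smooth_atlas :: "('a::topological_space, 'n::finite) chart set \<Rightarrow> bool" where
  "smooth_atlas charts \<longleftrightarrow>
     (\<Union>c\<in>charts. chart_dom c) = UNIV \<and>
     (\<forall>c\<in>charts. open (chart_dom c) \<and> open (chart_map c ` chart_dom c) \<and>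
        homeomorphism (chart_dom c) (chart_map c ` chart_dom c) (chart_map c) (chart_inv c)) \<and>
     (\<forall>c\<in>charts. \<forall>c'\<in>charts.
        smooth_on (chart_map c ` (chart_dom c \<inter> chart_dom c')) (chart_map c' \<circ> chart_inv c))"

definition Ck_function :: "('a, 'n::finite) chart set \<Rightarrow> nat \<Rightarrow> ('a \<Rightarrow> real) \<Rightarrow> bool" where
  "Ck_function charts k f \<longleftrightarrow>
     (\<forall>c\<in>charts. Ck_on k (chart_map c ` chart_dom c) (f \<circ> chart_inv c))"

text \<open>Used only for chart-independent expressions.\<close>

definition some_chart :: "('a, 'n::finite) chart set \<Rightarrow> 'a \<Rightarrow> ('a, 'n) chart" where
  "some_chart charts x = (SOME c. c \<in> charts \<and> x \<in> chart_dom c)"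


section \<open>Riemannian metrics\<close>

text \<open>A metric is given by its matrix of components \<open>g c x = (g\<^sub>i\<^sub>j(x))\<close> in each chart \<open>c\<close>;
  components in different charts are related by the transformation rule of a (0,2)-tensor.\<close>

definition riemannian_metric ::
  "('a, 'n::finite) chart set \<Rightarrow> (('a, 'n) chart \<Rightarrow> 'a \<Rightarrow> real^'n^'n) \<Rightarrow> bool" where
  "riemannian_metric charts g \<longleftrightarrow>
     (\<forall>c\<in>charts.
        smooth_on (chart_map c ` chart_dom c) (\<lambda>y. g c (chart_inv c y)) \<and>
        (\<forall>x\<in>chart_dom c. transpose (g c x) = g c x \<and> (\<forall>v. v \<noteq> 0 \<longrightarrow> v \<bullet> (g c x *v v) > 0))) \<and>
     (\<forall>c\<in>charts. \<forall>c'\<in>charts. \<forall>x \<in> chart_dom c \<inter> chart_dom c'.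
        let J = matrix (frechet_derivative (chart_map c' \<circ> chart_inv c) (at (chart_map c x)))
        in g c x = transpose J ** g c' x ** J)"


subsection \<open>Geodesic distance\<close>

definition C1_curve_on ::
  "('a::topological_space, 'n::finite) chart set \<Rightarrow> real \<Rightarrow> real \<Rightarrow> (real \<Rightarrow> 'a) \<Rightarrow> bool" where
  "C1_curve_on charts s t \<gamma> \<longleftrightarrow>
     continuous_on {s..t} \<gamma> \<and>
     (\<forall>c\<in>charts. let T = {u\<in>{s..t}. \<gamma> u \<in> chart_dom c} in
        \<exists>D. continuous_on T D \<and>
          (\<forall>u\<in>T. ((chart_map c \<circ> \<gamma>) has_vector_derivative D u) (at u within {s..t})))"

definition piecewise_C1_curve ::
  "('a::topological_space, 'n::finite) chart set \<Rightarrow> (real \<Rightarrow> 'a) \<Rightarrow> bool" where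
  "piecewise_C1_curve charts \<gamma> \<longleftrightarrow>
     continuous_on {0..1} \<gamma> \<and>
     (\<exists>S. finite S \<and> S \<subseteq> {0..1} \<and> 0 \<in> S \<and> 1 \<in> S \<and>
        (\<forall>s\<in>S. \<forall>t\<in>S. s < t \<and> {s<..<t} \<inter> S = {} \<longrightarrow> C1_curve_on charts s t \<gamma>))"

definition curve_speed ::
  "('a, 'n::finite) chart set \<Rightarrow> (('a, 'n) chart \<Rightarrow> 'a \<Rightarrow> real^'n^'n) \<Rightarrow> (real \<Rightarrow> 'a) \<Rightarrow> real \<Rightarrow> real" where
  "curve_speed charts g \<gamma> t =
     (let c = some_chart charts (\<gamma> t); v = vector_derivative (chart_map c \<circ> \<gamma>) (at t)
      in sqrt (v \<bullet> (g c (\<gamma> t) *v v)))"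

definition curve_length ::
  "('a, 'n::finite) chart set \<Rightarrow> (('a, 'n) chart \<Rightarrow> 'a \<Rightarrow> real^'n^'n) \<Rightarrow> (real \<Rightarrow> 'a) \<Rightarrow> real" where
  "curve_length charts g \<gamma> = integral {0..1} (curve_speed charts g \<gamma>)"

definition geodesic_dist ::
  "('a::topological_space, 'n::finite) chart set \<Rightarrow> (('a, 'n) chart \<Rightarrow> 'a \<Rightarrow> real^'n^'n) \<Rightarrow> 'a \<Rightarrow> 'a \<Rightarrow> real" where
  "geodesic_dist charts g x y =
     (INF \<gamma>\<in>{\<gamma>. piecewise_C1_curve charts \<gamma> \<and> \<gamma> 0 = x \<and> \<gamma> 1 = y}. curve_length charts g \<gamma>)"


subsection \<open>Complete connected Riemannian manifolds\<close>

text \<open>The distance of the type is required to be the geodesic distance.  This is no restriction on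
  the topology, because the geodesic distance of a connected Riemannian manifold induces the
  manifold topology.  Completeness and second countability come from the class
  \<^class>\<open>polish_space\<close>; completeness in the metric sense is geodesic completeness by
  Hopf--Rinow.\<close>

locale complete_riemannian_manifold =
  fixes charts :: "('a::polish_space, 'n::finite) chart set"
    and g :: "('a, 'n) chart \<Rightarrow> 'a \<Rightarrow> real^'n^'n"
  assumes atlas: "smooth_atlas charts"
    and metric: "riemannian_metric charts g"
    and connected: "connected (UNIV :: 'a set)"
    and dist_eq_geodesic: "\<And>x y. dist x y = geodesic_dist charts g x y"


subsection \<open>Volume measure\<close>

text \<open>The Riemannian volume is the unique Borel measure with density \<open>sqrt (det (g\<^sub>i\<^sub>j))\<close> with respect
  to Lebesgue measure in every chart.\<close>

definition riemannian_volume ::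
  "('a::topological_space, 'n::finite) chart set \<Rightarrow> (('a, 'n) chart \<Rightarrow> 'a \<Rightarrow> real^'n^'n) \<Rightarrow> 'a measure \<Rightarrow> bool" where
  "riemannian_volume charts g vol \<longleftrightarrow>
     sets vol = sets borel \<and>
     (\<forall>c\<in>charts. \<forall>B\<in>sets borel. B \<subseteq> chart_dom c \<longrightarrow>
        emeasure vol B =
          (\<integral>\<^sup>+y. ennreal (sqrt (det (g c (chart_inv c y)))) * indicator (chart_map c ` B) y \<partial>lborel))"


section \<open>The generator\<close>

definition coord_deriv :: "'n::finite \<Rightarrow> (real^'n \<Rightarrow> real) \<Rightarrow> real^'n \<Rightarrow> real" where
  "coord_deriv i F y = frechet_derivative F (at y) (axis i 1)"

text \<open>Components of the gradient, \<open>\<Sum>\<^sub>j g\<^sup>i\<^sup>j \<partial>\<^sub>j f\<close>, at the point with coordinates \<open>y\<close>.\<close>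

definition gradient ::
  "(('a, 'n::finite) chart \<Rightarrow> 'a \<Rightarrow> real^'n^'n) \<Rightarrow> ('a, 'n) chart \<Rightarrow> ('a \<Rightarrow> real) \<Rightarrow> real^'n \<Rightarrow> real^'n" where
  "gradient g c f y = matrix_inv (g c (chart_inv c y)) *v (\<chi> j. coord_deriv j (f \<circ> chart_inv c) y)"

text \<open>Divergence of the vector field with components \<open>X\<close>, as
  \<open>(1 / sqrt (det g)) \<Sum>\<^sub>i \<partial>\<^sub>i (sqrt (det g) X\<^sup>i)\<close>.\<close>

definition divergence ::
  "(('a, 'n::finite) chart \<Rightarrow> 'a \<Rightarrow> real^'n^'n) \<Rightarrow> ('a, 'n) chart \<Rightarrow> (real^'n \<Rightarrow> real^'n) \<Rightarrow> real^'n \<Rightarrow> real" where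
  "divergence g c X y =
     (let \<rho> = (\<lambda>z. sqrt (det (g c (chart_inv c z))))
      in (\<Sum>i\<in>UNIV. coord_deriv i (\<lambda>z. \<rho> z * X z $ i) y) / \<rho> y)"

text \<open>\<open>L f = 1/2 div (\<nabla> f) - 1/2 \<nabla> V \<cdot> \<nabla> f\<close>, the dot being the Riemannian inner product.\<close>

definition generator ::
  "('a, 'n::finite) chart set \<Rightarrow> (('a, 'n) chart \<Rightarrow> 'a \<Rightarrow> real^'n^'n) \<Rightarrow> ('a \<Rightarrow> real) \<Rightarrow> ('a \<Rightarrow> real) \<Rightarrow> 'a \<Rightarrow> real" where
  "generator charts g V f x =
     (let c = some_chart charts x; y = chart_map c x
      in divergence g c (gradient g c f) y / 2
         - (gradient g c V y \<bullet> (g c x *v gradient g c f y)) / 2)"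


section \<open>Diffusions, explosion\<close>

text \<open>Paths with possibly finite lifetime: \<^term>\<open>None\<close> is the cemetery, i.e. the point at infinity of
  the one-point compactification, and is absorbing.  Only times in \<open>{0..}\<close> matter.\<close>

definition explosive_paths :: "(real \<Rightarrow> 'a::topological_space option) set" where
  "explosive_paths =
     {\<omega>. continuous_map (top_of_set {0..}) (Alexandroff_compactification euclidean) \<omega> \<and>
         (\<forall>s t. 0 \<le> s \<and> s \<le> t \<and> \<omega> s = None \<longrightarrow> \<omega> t = None)}"

definition lifetime :: "(real \<Rightarrow> 'a option) \<Rightarrow> ereal" where
  "lifetime \<omega> = (INF t\<in>{t. 0 \<le> t \<and> \<omega> t = None}. ereal t)"

text \<open>\<open>path_algebra T\<close> is generated by the coordinates at times in \<open>T\<close>.\<close>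

definition path_algebra :: "real set \<Rightarrow> (real \<Rightarrow> 'a::topological_space option) measure" where
  "path_algebra T =
     sigma explosive_paths {{\<omega>\<in>explosive_paths. \<omega> s \<in> Some ` A} | s A. s \<in> T \<and> A \<in> sets borel}"

definition martingale ::
  "'w measure \<Rightarrow> (real \<Rightarrow> 'w measure) \<Rightarrow> (real \<Rightarrow> 'w \<Rightarrow> real) \<Rightarrow> bool" where
  "martingale P F M \<longleftrightarrow>
     (\<forall>t\<ge>0. subalgebra P (F t) \<and> integrable P (M t) \<and> M t \<in> borel_measurable (F t)) \<and>
     (\<forall>s t. 0 \<le> s \<and> s \<le> t \<longrightarrow> (AE \<omega> in P. real_cond_exp P (F s) (M t) \<omega> = M s \<omega>))"

definition test_function :: "('a::topological_space, 'n::finite) chart set \<Rightarrow> ('a \<Rightarrow> real) \<Rightarrow> bool" where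
  "test_function charts f \<longleftrightarrow>
     (\<forall>k. Ck_function charts k f) \<and> (\<exists>K. compact K \<and> (\<forall>x. x \<notin> K \<longrightarrow> f x = 0))"

text \<open>Law of the diffusion with generator \<open>L\<close> started at \<open>x\<close>, as a solution of the martingale
  problem up to the lifetime; functions are extended by \<open>0\<close> to the cemetery.\<close>

definition at_state :: "('a \<Rightarrow> real) \<Rightarrow> 'a option \<Rightarrow> real" where
  "at_state f z = (case z of None \<Rightarrow> 0 | Some x \<Rightarrow> f x)"

definition diffusion_law ::
  "('a::topological_space, 'n::finite) chart set \<Rightarrow> (('a \<Rightarrow> real) \<Rightarrow> 'a \<Rightarrow> real) \<Rightarrow> 'a
     \<Rightarrow> (real \<Rightarrow> 'a option) measure \<Rightarrow> bool" where
  "diffusion_law charts L x P \<longleftrightarrow>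
     prob_space P \<and> space P = explosive_paths \<and> sets P = sets (path_algebra {0..}) \<and>
     (AE \<omega> in P. \<omega> 0 = Some x) \<and>
     (\<forall>f. test_function charts f \<longrightarrow>
        martingale P (\<lambda>t. path_algebra {0..t})
          (\<lambda>t \<omega>. at_state f (\<omega> t) - at_state f (\<omega> 0) - integral {0..t} (\<lambda>s. at_state (L f) (\<omega> s))))"

definition non_explosive ::
  "('a::topological_space, 'n::finite) chart set \<Rightarrow> (('a \<Rightarrow> real) \<Rightarrow> 'a \<Rightarrow> real) \<Rightarrow> bool" where
  "non_explosive charts L \<longleftrightarrow>
     (\<forall>x. \<exists>P. diffusion_law charts L x P \<and> (AE \<omega> in P. lifetime \<omega> = \<infinity>))"


section \<open>Relative entropy, Wasserstein distance, truncation\<close>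

text \<open>\<open>H(\<nu>, \<mu>)\<close>.  Not \<^const>\<open>KL_divergence\<close>, which is real-valued and \<open>0\<close> where the
  entropy is infinite.  The integral of the negative part is finite for probability measures.\<close>

definition rel_entropy :: "'a measure \<Rightarrow> 'a measure \<Rightarrow> ereal" where
  "rel_entropy \<nu> \<mu> =
     (if absolutely_continuous \<mu> \<nu> then
        enn2ereal (\<integral>\<^sup>+x. ennreal (ln (enn2real (RN_deriv \<mu> \<nu> x))) \<partial>\<nu>)
        - enn2ereal (\<integral>\<^sup>+x. ennreal (- ln (enn2real (RN_deriv \<mu> \<nu> x))) \<partial>\<nu>)
      else \<infinity>)"

definition couplings :: "'a::topological_space measure \<Rightarrow> 'a measure \<Rightarrow> ('a \<times> 'a) measure set" where
  "couplings \<nu> \<nu>' =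
     {\<pi>. sets \<pi> = sets (borel \<Otimes>\<^sub>M borel) \<and> prob_space \<pi> \<and>
         distr \<pi> borel fst = \<nu> \<and> distr \<pi> borel snd = \<nu>'}"

definition W2 :: "'a::metric_space measure \<Rightarrow> 'a measure \<Rightarrow> ennreal" where
  "W2 \<nu> \<nu>' =
     (let I = (INF \<pi>\<in>couplings \<nu> \<nu>'. \<integral>\<^sup>+(x, y). ennreal ((dist x y)\<^sup>2) \<partial>\<pi>)
      in if I = \<infinity> then \<infinity> else ennreal (sqrt (enn2real I)))"

text \<open>\<open>\<nu> = h \<mu>\<close> and its truncation \<open>\<nu>\<^sub>a\<close>, for a nonnegative density \<open>h\<close>.\<close>

definition with_density :: "'a measure \<Rightarrow> ('a \<Rightarrow> real) \<Rightarrow> 'a measure" where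
  "with_density \<mu> h = density \<mu> (\<lambda>x. ennreal (h x))"

definition truncated :: "'a measure \<Rightarrow> ('a \<Rightarrow> real) \<Rightarrow> real \<Rightarrow> 'a measure" where
  "truncated \<mu> h a =
     with_density \<mu> (\<lambda>x. 1 / measure (with_density \<mu> h) {x \<in> space \<mu>. h x \<le> a}
                           * h x * indicator {x. h x \<le> a} x)"

definition prob_density :: "'a measure \<Rightarrow> ('a \<Rightarrow> real) \<Rightarrow> bool" where
  "prob_density \<mu> h \<longleftrightarrow>
     h \<in> borel_measurable \<mu> \<and> (\<forall>x. 0 \<le> h x) \<and> prob_space (with_density \<mu> h)"

definition Var_Ent :: "'a::metric_space measure \<Rightarrow> 'a \<Rightarrow> real \<Rightarrow> bool" where
  "Var_Ent \<mu> x\<^sub>0 a \<longleftrightarrow>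
     (\<exists>D::real. \<forall>h. prob_density \<mu> h \<and> rel_entropy (with_density \<mu> h) \<mu> \<le> 1/2 \<longrightarrow>
        enn2ereal (\<integral>\<^sup>+x. ennreal ((dist x x\<^sub>0)\<^sup>2) * indicator {x. h x > a} x \<partial>with_density \<mu> h)
          \<le> ereal D * rel_entropy (with_density \<mu> h) \<mu>)"

definition Tronc :: "'a::metric_space measure \<Rightarrow> real \<Rightarrow> bool" where
  "Tronc \<mu> a \<longleftrightarrow>
     (\<exists>c::real. \<forall>h. prob_density \<mu> h \<and> rel_entropy (with_density \<mu> h) \<mu> \<le> 1/2 \<longrightarrow>
        enn2ereal ((W2 (truncated \<mu> h a) (with_density \<mu> h))\<^sup>2)
          \<le> ereal c * rel_entropy (with_density \<mu> h) \<mu>)"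

end

theory Submission
  imports Defs
begin

text \<open>
  Transport \<open>\<nu>\<close> to its truncation \<open>\<nu>\<^sub>a\<close> by leaving the mass on \<open>{h \<le> a}\<close> in place and replacing every
  point of \<open>{h > a}\<close> by an independent sample from \<open>\<nu>\<^sub>a\<close>. This works because \<open>\<nu>\<^sub>a\<close> is \<open>\<nu>\<close> conditioned on
  \<open>{h \<le> a}\<close>. As only the points of \<open>{h > a}\<close> move, bounding \<open>d(x, y)\<^sup>2\<close> by
  \<open>2 d(x, x\<^sub>0)\<^sup>2 + 2 d(y, x\<^sub>0)\<^sup>2\<close> shows (lemma \<open>W2_uniform_measure_le\<close>) that \<open>W\<^sub>2(\<nu>\<^sub>a, \<nu>)\<^sup>2\<close> is at most
  \<open>2 \<nu>(h > a) \<integral> d(x, x\<^sub>0)\<^sup>2 d\<nu>\<^sub>a(x) + 2 \<integral> d(y, x\<^sub>0)\<^sup>2 1{h > a} d\<nu>(y)\<close>.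
  The second term is what (Var-Ent) controls.

  In the first term, the mass \<open>\<nu>(h > a)\<close> supplies the factor \<open>H(\<nu>, \<mu>)\<close>. Since \<open>\<nu>\<close> and \<open>\<mu>\<close> have the
  same mass, \<open>H(\<nu>, \<mu>)\<close> is the \<open>\<mu>\<close>-integral of \<open>h ln h - h + 1\<close>. This function is nonnegative, and it
  is at least \<open>(ln a - 1) h\<close> where \<open>h > a\<close>. Hence \<open>\<nu>(h > a) \<le> H(\<nu>, \<mu>) / (ln a - 1)\<close> (lemma
  \<open>rel_entropy_tail\<close>). The condition \<open>a > exp (3/2)\<close> is exactly \<open>ln a - 1 > 1/2\<close>, so entropy at most
  \<open>1/2\<close> keeps \<open>\<nu>(h > a)\<close> below a constant less than \<open>1\<close> that depends on \<open>a\<close> alone, and \<open>\<nu>(h \<le> a)\<close> above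
  some \<open>p\<^sub>0 > 0\<close>. Thus \<open>\<nu>\<^sub>a\<close> has density at most \<open>a / p\<^sub>0\<close> with respect to \<open>\<mu>\<close>, and its second moment is
  bounded uniformly in \<open>h\<close> by that of \<open>\<mu>\<close>, which is finite by the exponential integrability.
\<close>

section \<open>Coupling a measure with its conditioning on an event\<close>

text \<open>With an infinite infimum \<^const>\<open>W2\<close> is \<open>\<infinity>\<close> rather than the square root of a default value, so
  squaring undoes the root in every case.\<close>

lemma W2_power2:
  "(W2 \<nu> \<nu>')\<^sup>2 = (INF \<pi>\<in>couplings \<nu> \<nu>'. \<integral>\<^sup>+(x, y). ennreal ((dist x y)\<^sup>2) \<partial>\<pi>)"
proof -
  define I where "I = (INF \<pi>\<in>couplings \<nu> \<nu>'. \<integral>\<^sup>+(x, y). ennreal ((dist x y)\<^sup>2) \<partial>\<pi>)"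
  have "(if I = \<infinity> then \<infinity> else ennreal (sqrt (enn2real I)))\<^sup>2 = I"
    by (cases I) (auto simp: power2_eq_square simp flip: ennreal_mult)
  then show ?thesis
    unfolding W2_def I_def Let_def .
qed

lemma dist_power2_le: "(dist x y)\<^sup>2 \<le> 2 * (dist x z)\<^sup>2 + 2 * (dist y z)\<^sup>2"
proof -
  have "(dist x y)\<^sup>2 \<le> (dist x z + dist y z)\<^sup>2"
    by (intro power_mono dist_triangle2) auto
  also have "\<dots> \<le> 2 * (dist x z)\<^sup>2 + 2 * (dist y z)\<^sup>2"
    using sum_squares_bound[of "dist x z" "dist y z"] by (simp add: power2_sum)
  finally show ?thesis .
qed

text \<open>If \<open>y\<close> has law \<open>\<nu>\<close> and \<open>x\<close> is independent with law \<open>\<nu>\<close> conditioned on \<open>A\<close>, the image is the pair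
  of the corrected and the original point: a \<open>y\<close> outside \<open>A\<close> is redrawn.\<close>

definition resample :: "'a set \<Rightarrow> 'a \<times> 'a \<Rightarrow> 'a \<times> 'a" where
  "resample A = (\<lambda>(x, y). (if y \<in> A then y else x, y))"

lemma measurable_resample [measurable]:
  assumes [measurable]: "A \<in> sets M"
  shows "resample A \<in> M \<Otimes>\<^sub>M M \<rightarrow>\<^sub>M M \<Otimes>\<^sub>M M"
  unfolding resample_def by measurable

text \<open>With \<open>\<kappa>\<close> the conditioned measure, the corrected point lies in \<open>B\<close> with probability
  \<open>\<nu>(A \<inter> B) + \<kappa>(B) \<nu>(- A)\<close>. The first term is \<open>\<kappa>(B) \<nu>(A)\<close>, so this is \<open>\<kappa>(B)\<close>. The second
  coordinate is left untouched.\<close>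

lemma resample_coupling:
  fixes \<nu> :: "'a::polish_space measure"
  assumes "prob_space \<nu>" and sets_\<nu>: "sets \<nu> = sets borel"
    and A: "A \<in> sets \<nu>" and "emeasure \<nu> A \<noteq> 0"
  defines "\<kappa> \<equiv> uniform_measure \<nu> A"
  shows "distr (\<kappa> \<Otimes>\<^sub>M \<nu>) (borel \<Otimes>\<^sub>M borel) (resample A) \<in> couplings \<kappa> \<nu>"
proof -
  interpret \<nu>: prob_space \<nu> by fact
  have [measurable_cong]: "sets \<nu> = sets borel" "sets \<kappa> = sets borel"
    using sets_\<nu> by (simp_all add: \<kappa>_def)
  have [measurable]: "A \<in> sets borel"
    using A sets_\<nu> by simp
  have space: "space \<nu> = UNIV"
    using sets_eq_imp_space_eq[OF sets_\<nu>] by simp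
  interpret \<kappa>: prob_space \<kappa>
    unfolding \<kappa>_def using assms(4) by (intro prob_space_uniform_measure) auto
  have space': "space \<kappa> = UNIV"
    by (simp add: \<kappa>_def space)
  interpret P: pair_prob_space \<kappa> \<nu> ..
  let ?\<pi> = "distr (\<kappa> \<Otimes>\<^sub>M \<nu>) (borel \<Otimes>\<^sub>M borel) (resample A)"
  have "prob_space ?\<pi>"
    by (intro P.prob_space_distr) measurable
  moreover have "distr ?\<pi> borel fst = \<kappa>"
  proof (rule measure_eqI)
    fix B assume "B \<in> sets (distr ?\<pi> borel fst)"
    then have [measurable]: "B \<in> sets borel" by simp
    have "emeasure (distr ?\<pi> borel fst) B
        = emeasure (\<kappa> \<Otimes>\<^sub>M \<nu>) ((UNIV \<times> (A \<inter> B)) \<union> (B \<times> (- A)))"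
      by (simp add: emeasure_distr distr_distr space_pair_measure space space')
        (rule arg_cong[where f="emeasure (\<kappa> \<Otimes>\<^sub>M \<nu>)"], auto simp: resample_def split: if_splits)
    also have "\<dots> = emeasure (\<kappa> \<Otimes>\<^sub>M \<nu>) (UNIV \<times> (A \<inter> B)) + emeasure (\<kappa> \<Otimes>\<^sub>M \<nu>) (B \<times> (- A))"
      by (rule plus_emeasure[symmetric]) (auto intro!: pair_measureI)
    also have "\<dots> = emeasure \<nu> (A \<inter> B) + emeasure \<kappa> B * emeasure \<nu> (- A)"
      using \<kappa>.emeasure_space_1 by (simp add: \<nu>.emeasure_pair_measure_Times space')
    also have "emeasure \<nu> (A \<inter> B) = emeasure \<kappa> B * emeasure \<nu> A"
      using assms(4) by (simp add: \<kappa>_def A sets_\<nu> ennreal_divide_times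
          less_top[symmetric] flip: ennreal_times_divide)
    also have "emeasure \<kappa> B * emeasure \<nu> A + emeasure \<kappa> B * emeasure \<nu> (- A)
        = emeasure \<kappa> B * emeasure \<nu> (A \<union> - A)"
      by (subst plus_emeasure[symmetric]) (auto simp: distrib_left)
    also have "\<dots> = emeasure \<kappa> B"
      using \<nu>.emeasure_space_1 by (simp add: space)
    finally show "emeasure (distr ?\<pi> borel fst) B = emeasure \<kappa> B" .
  qed (simp add: \<kappa>_def sets_\<nu>)
  moreover have "distr ?\<pi> borel snd = \<nu>"
  proof -
    have "emeasure (distr ?\<pi> borel snd) B = emeasure \<nu> B" if "B \<in> sets borel" for B
    proof -
      note [measurable] = that
      have "emeasure (distr ?\<pi> borel snd) B = emeasure (\<kappa> \<Otimes>\<^sub>M \<nu>) (UNIV \<times> B)"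
        by (simp add: emeasure_distr distr_distr space_pair_measure space space')
          (rule arg_cong[where f="emeasure (\<kappa> \<Otimes>\<^sub>M \<nu>)"], auto simp: resample_def)
      also have "\<dots> = emeasure \<nu> B"
        using \<kappa>.emeasure_space_1 by (simp add: \<nu>.emeasure_pair_measure_Times space')
      finally show ?thesis .
    qed
    then show ?thesis
      by (intro measure_eqI) (simp_all add: sets_\<nu>)
  qed
  ultimately show ?thesis
    by (simp add: couplings_def)
qed

text \<open>The cost of \<^const>\<open>resample\<close>: no transport over \<open>A\<close>, and over \<open>- A\<close> the two points are
  independent, so that after passing through \<open>z\<close> the cost separates into a \<open>\<kappa>\<close>-part and a \<open>\<nu>\<close>-part.\<close>

lemma W2_uniform_measure_le:
  fixes \<nu> :: "'a::polish_space measure"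
  assumes "prob_space \<nu>" and sets_\<nu>: "sets \<nu> = sets borel"
    and A: "A \<in> sets \<nu>" and "emeasure \<nu> A \<noteq> 0"
  defines "\<kappa> \<equiv> uniform_measure \<nu> A"
  shows "(W2 \<kappa> \<nu>)\<^sup>2 \<le> 2 * (emeasure \<nu> (- A) * (\<integral>\<^sup>+x. ennreal ((dist x z)\<^sup>2) \<partial>\<kappa>))
           + 2 * (\<integral>\<^sup>+x. ennreal ((dist x z)\<^sup>2) * indicator (- A) x \<partial>\<nu>)"
proof -
  interpret \<nu>: prob_space \<nu> by fact
  have [measurable_cong]: "sets \<nu> = sets borel" "sets \<kappa> = sets borel"
    using sets_\<nu> by (simp_all add: \<kappa>_def)
  have [measurable]: "A \<in> sets borel"
    using A sets_\<nu> by simp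
  interpret \<kappa>: prob_space \<kappa>
    unfolding \<kappa>_def using assms(4) by (intro prob_space_uniform_measure) auto
  let ?\<pi> = "distr (\<kappa> \<Otimes>\<^sub>M \<nu>) (borel \<Otimes>\<^sub>M borel) (resample A)"
  let ?m = "\<lambda>x. ennreal ((dist x z)\<^sup>2)"
  have "(W2 \<kappa> \<nu>)\<^sup>2 \<le> (\<integral>\<^sup>+(x, y). ennreal ((dist x y)\<^sup>2) \<partial>?\<pi>)"
    unfolding W2_power2 \<kappa>_def by (intro INF_lower resample_coupling assms)
  also have "\<dots> = (\<integral>\<^sup>+p. (case resample A p of (x, y) \<Rightarrow> ennreal ((dist x y)\<^sup>2)) \<partial>(\<kappa> \<Otimes>\<^sub>M \<nu>))"
    by (rule nn_integral_distr) measurable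
  also have "\<dots> \<le> (\<integral>\<^sup>+(x, y). indicator (- A) y * (2 * ?m x + 2 * ?m y) \<partial>(\<kappa> \<Otimes>\<^sub>M \<nu>))"
  proof (intro nn_integral_mono, clarsimp simp: resample_def)
    fix x y assume "y \<notin> A"
    show "ennreal ((dist x y)\<^sup>2) \<le> 2 * ?m x + 2 * ?m y"
      using ennreal_leI[OF dist_power2_le[of x y z]]
      by (simp add: ennreal_plus ennreal_mult)
  qed
  also have "\<dots> = (\<integral>\<^sup>+x. \<integral>\<^sup>+y. indicator (- A) y * (2 * ?m x + 2 * ?m y) \<partial>\<nu> \<partial>\<kappa>)"
    by (subst \<nu>.nn_integral_fst[symmetric]) (auto simp: case_prod_beta)
  also have "\<dots> = (\<integral>\<^sup>+x. 2 * (emeasure \<nu> (- A) * ?m x) + 2 * (\<integral>\<^sup>+y. ?m y * indicator (- A) y \<partial>\<nu>) \<partial>\<kappa>)"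
  proof (rule nn_integral_cong)
    fix x
    have "(\<integral>\<^sup>+y. indicator (- A) y * (2 * ?m x + 2 * ?m y) \<partial>\<nu>)
        = (\<integral>\<^sup>+y. (2 * ?m x) * indicator (- A) y + 2 * (?m y * indicator (- A) y) \<partial>\<nu>)"
      by (intro nn_integral_cong) (auto simp: indicator_def)
    also have "\<dots> = 2 * (emeasure \<nu> (- A) * ?m x) + 2 * (\<integral>\<^sup>+y. ?m y * indicator (- A) y \<partial>\<nu>)"
      by (simp add: nn_integral_add nn_integral_cmult nn_integral_cmult_indicator mult.assoc
          mult.commute[of "ennreal _" "emeasure _ _"])
    finally show "(\<integral>\<^sup>+y. indicator (- A) y * (2 * ?m x + 2 * ?m y) \<partial>\<nu>)
        = 2 * (emeasure \<nu> (- A) * ?m x) + 2 * (\<integral>\<^sup>+y. ?m y * indicator (- A) y \<partial>\<nu>)" .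
  qed
  also have "\<dots> = 2 * (emeasure \<nu> (- A) * (\<integral>\<^sup>+x. ?m x \<partial>\<kappa>))
      + 2 * (\<integral>\<^sup>+x. ?m x * indicator (- A) x \<partial>\<nu>)"
    by (subst nn_integral_add) (auto simp: nn_integral_cmult \<kappa>.emeasure_space_1)
  finally show ?thesis .
qed


section \<open>Mass of the large values of a density of finite entropy\<close>

text \<open>The Radon-Nikodym derivative is only almost everywhere equal to \<open>h\<close>; this passes to integrals
  with respect to the fixed measure \<open>\<mu>\<close>.\<close>

lemma rel_entropy_with_density:
  assumes "prob_space \<mu>" and "prob_density \<mu> h"
  shows "rel_entropy (with_density \<mu> h) \<mu>
    = enn2ereal (\<integral>\<^sup>+x. ennreal (h x * ln (h x)) \<partial>\<mu>) - enn2ereal (\<integral>\<^sup>+x. ennreal (- (h x * ln (h x))) \<partial>\<mu>)"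
proof -
  interpret prob_space \<mu> by fact
  have [measurable]: "h \<in> borel_measurable \<mu>" and h: "\<And>x. 0 \<le> h x"
    using assms by (auto simp: prob_density_def)
  let ?\<nu> = "with_density \<mu> h"
  have ac: "absolutely_continuous \<mu> ?\<nu>"
    unfolding with_density_def by (rule absolutely_continuousI_density) measurable
  have RN: "AE x in \<mu>. RN_deriv \<mu> ?\<nu> x = ennreal (h x)"
    by (rule AE_symmetric[OF RN_deriv_unique]) (auto simp: with_density_def)
  have *: "(\<integral>\<^sup>+x. ennreal (s * ln (enn2real (RN_deriv \<mu> ?\<nu> x))) \<partial>?\<nu>)
      = (\<integral>\<^sup>+x. ennreal (s * (h x * ln (h x))) \<partial>\<mu>)" for s :: real
  proof -
    have "(\<integral>\<^sup>+x. ennreal (s * ln (enn2real (RN_deriv \<mu> ?\<nu> x))) \<partial>?\<nu>)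
        = (\<integral>\<^sup>+x. ennreal (h x) * ennreal (s * ln (enn2real (RN_deriv \<mu> ?\<nu> x))) \<partial>\<mu>)"
      by (subst (1) with_density_def, rule nn_integral_density) measurable
    also have "\<dots> = (\<integral>\<^sup>+x. ennreal (s * (h x * ln (h x))) \<partial>\<mu>)"
      using RN by (intro nn_integral_cong_AE, eventually_elim)
        (simp add: h ennreal_mult'[symmetric] ac_simps)
    finally show ?thesis .
  qed
  show ?thesis
    using *[of 1] *[of "-1"] ac by (simp add: rel_entropy_def)
qed

lemma mult_ln_ge:
  fixes t :: real
  assumes "0 \<le> t"
  shows "t - 1 \<le> t * ln t"
proof (cases "t = 0")
  case False
  then have "1 - 1 / t \<le> ln t"
    using assms ln_le_minus_one[of "1 / t"] by (simp add: ln_div)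
  then show ?thesis
    using assms False mult_left_mono[of "1 - 1 / t" "ln t" t] by (simp add: right_diff_distrib)
qed simp

text \<open>A Markov-type inequality for \<open>h ln h - h + 1 \<ge> 0\<close>, whose \<open>\<mu>\<close>-integral is the entropy. The
  positive part \<open>A\<close> of the entropy may be infinite, so the pointwise inequality is arranged with
  nonnegative terms on both sides and integrated in that form; the negative part \<open>B\<close>, being at most
  \<open>1\<close>, is subtracted only at the end.\<close>

lemma rel_entropy_tail:
  assumes "prob_space \<mu>" and "prob_density \<mu> h" and a: "a > 0" "ln a \<ge> 1"
  shows "ereal ((ln a - 1) * measure (with_density \<mu> h) {x \<in> space \<mu>. h x > a})
    \<le> rel_entropy (with_density \<mu> h) \<mu>"
proof -
  interpret prob_space \<mu> by fact
  have [measurable]: "h \<in> borel_measurable \<mu>" and h: "\<And>x. 0 \<le> h x"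
    and prob: "prob_space (with_density \<mu> h)"
    using assms by (auto simp: prob_density_def)
  let ?\<nu> = "with_density \<mu> h" and ?S = "{x \<in> space \<mu>. h x > a}"
  define A where "A = (\<integral>\<^sup>+x. ennreal (h x * ln (h x)) \<partial>\<mu>)"
  define B where "B = (\<integral>\<^sup>+x. ennreal (- (h x * ln (h x))) \<partial>\<mu>)"
  interpret \<nu>: prob_space ?\<nu> by fact
  have mass: "(\<integral>\<^sup>+x. ennreal (h x) \<partial>\<mu>) = 1"
    using \<nu>.emeasure_space_1 by (simp add: with_density_def emeasure_density)
  have "B \<le> (\<integral>\<^sup>+x. 1 \<partial>\<mu>)"
    unfolding B_def
  proof (intro nn_integral_mono)
    fix x show "ennreal (- (h x * ln (h x))) \<le> 1"
      using mult_ln_ge[OF h[of x]] h[of x] by (intro ennreal_le_1[THEN iffD2]) linarith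
  qed
  then have B: "B \<le> 1"
    by (simp add: emeasure_space_1)
  have "emeasure ?\<nu> ?S = (\<integral>\<^sup>+x. ennreal (h x) * indicator ?S x \<partial>\<mu>)"
    by (simp add: with_density_def emeasure_density)
  then have "ennreal ((ln a - 1) * measure ?\<nu> ?S) + B + 1
      = (\<integral>\<^sup>+x. ennreal (ln a - 1) * (ennreal (h x) * indicator ?S x)
           + ennreal (- (h x * ln (h x))) + ennreal (h x) \<partial>\<mu>)"
    using a by (simp add: nn_integral_add nn_integral_cmult ennreal_mult mass B_def
        \<nu>.emeasure_eq_measure)
  also have "\<dots> \<le> (\<integral>\<^sup>+x. ennreal (h x * ln (h x)) + 1 \<partial>\<mu>)"
  proof (intro nn_integral_mono)
    fix x assume x: "x \<in> space \<mu>"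
    let ?l = "h x * ln (h x)"
    have "(ln a - 1) * (h x * indicator ?S x) + max 0 (- ?l) + h x \<le> max 0 ?l + 1"
    proof (cases "h x > a")
      case True
      then have "ln a \<le> ln (h x)" using a by simp
      then have "ln a * h x \<le> ?l"
        using h[of x] by (subst mult.commute) (intro mult_left_mono)
      moreover have "0 \<le> ?l"
        using \<open>ln a \<le> ln (h x)\<close> a h by simp
      ultimately show ?thesis
        using True x by (simp add: left_diff_distrib)
    next
      case False
      then show ?thesis
        using mult_ln_ge[OF h[of x]] by auto
    qed
    from ennreal_leI[OF this]
    show "ennreal (ln a - 1) * (ennreal (h x) * indicator ?S x) + ennreal (- ?l) + ennreal (h x)
        \<le> ennreal ?l + 1"
      using a h[of x]
      by (simp add: ennreal_plus ennreal_mult ennreal_max_0 ennreal_max_0' ennreal_indicator)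
  qed
  also have "\<dots> = A + 1"
    by (simp add: nn_integral_add A_def emeasure_space_1)
  finally have "ennreal ((ln a - 1) * measure ?\<nu> ?S) + B \<le> A"
    by (simp add: ennreal_add_left_cancel_le add.commute[of _ 1])
  moreover have "0 \<le> (ln a - 1) * measure ?\<nu> ?S"
    using a by simp
  ultimately have "ereal ((ln a - 1) * measure ?\<nu> ?S) \<le> enn2ereal A - enn2ereal B"
    using B
    by (cases A; cases B) (auto simp: ennreal_plus[symmetric] enn2ereal_ennreal top_unique simp del: ennreal_plus)
  then show ?thesis
    by (simp add: rel_entropy_with_density[OF assms(1,2)] A_def B_def)
qed


section \<open>Variance-entropy bound implies truncation bound\<close>

lemma truncated_eq_uniform_measure:
  assumes "prob_density \<mu> h" and "measure (with_density \<mu> h) {x \<in> space \<mu>. h x \<le> a} \<noteq> 0"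
  shows "truncated \<mu> h a = uniform_measure (with_density \<mu> h) {x \<in> space \<mu>. h x \<le> a}"
proof -
  have [measurable]: "h \<in> borel_measurable \<mu>" and h: "\<And>x. 0 \<le> h x"
    and prob: "prob_space (with_density \<mu> h)"
    using assms by (auto simp: prob_density_def)
  interpret \<nu>: prob_space "with_density \<mu> h" by fact
  let ?A = "{x \<in> space \<mu>. h x \<le> a}"
  define p where "p = measure (with_density \<mu> h) ?A"
  have p: "p > 0"
    using assms(2) by (simp add: p_def zero_less_measure_iff)
  have "uniform_measure (with_density \<mu> h) ?A
      = density \<mu> (\<lambda>x. ennreal (h x) * (indicator ?A x / ennreal p))"
    unfolding uniform_measure_def \<nu>.emeasure_eq_measure p_def[symmetric]
    by (subst with_density_def, subst density_density_eq) auto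
  also have "\<dots> = truncated \<mu> h a"
    unfolding truncated_def p_def[symmetric] with_density_def[of \<mu> "\<lambda>x. _ x * _ x"]
    using p h by (intro density_cong)
      (auto simp: indicator_def divide_ennreal ennreal_mult''[symmetric] ennreal_mult'[symmetric]
        simp flip: ennreal_1)
  finally show ?thesis ..
qed

lemma second_moment_truncated_le:
  fixes \<mu> :: "'a::metric_space measure"
  assumes sets: "sets \<mu> = sets borel" and "prob_density \<mu> h" and "a \<ge> 0"
  shows "(\<integral>\<^sup>+x. ennreal ((dist x z)\<^sup>2) \<partial>truncated \<mu> h a)
    \<le> ennreal (a / measure (with_density \<mu> h) {x \<in> space \<mu>. h x \<le> a})
      * (\<integral>\<^sup>+x. ennreal ((dist x z)\<^sup>2) \<partial>\<mu>)"
proof -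
  have [measurable]: "h \<in> borel_measurable \<mu>" and h: "\<And>x. 0 \<le> h x"
    using assms by (auto simp: prob_density_def)
  note [measurable_cong] = sets
  have [measurable]: "(\<lambda>x. dist x z) \<in> borel_measurable borel"
    by (intro borel_measurable_continuous_onI continuous_intros)
  define p where "p = measure (with_density \<mu> h) {x \<in> space \<mu>. h x \<le> a}"
  have p: "p \<ge> 0" by (simp add: p_def)
  have "(\<integral>\<^sup>+x. ennreal ((dist x z)\<^sup>2) \<partial>truncated \<mu> h a)
      = (\<integral>\<^sup>+x. ennreal (1 / p * h x * indicator {x. h x \<le> a} x) * ennreal ((dist x z)\<^sup>2) \<partial>\<mu>)"
    unfolding truncated_def with_density_def p_def[unfolded with_density_def, symmetric]
    by (rule nn_integral_density) measurable
  also have "\<dots> \<le> (\<integral>\<^sup>+x. ennreal (a / p) * ennreal ((dist x z)\<^sup>2) \<partial>\<mu>)"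
    using p \<open>a \<ge> 0\<close> by (intro nn_integral_mono mult_right_mono ennreal_leI)
      (auto simp: indicator_def intro: divide_right_mono)
  also have "\<dots> = ennreal (a / p) * (\<integral>\<^sup>+x. ennreal ((dist x z)\<^sup>2) \<partial>\<mu>)"
    by (rule nn_integral_cmult) measurable
  finally show ?thesis
    by (simp add: p_def)
qed

lemma second_moment_finite:
  fixes \<mu> :: "'a::metric_space measure"
  assumes sets: "sets \<mu> = sets borel" and "\<epsilon> > 0"
    and fin: "(\<integral>\<^sup>+x. ennreal (exp (\<epsilon> * (dist x z)\<^sup>2)) \<partial>\<mu>) < \<infinity>"
  shows "(\<integral>\<^sup>+x. ennreal ((dist x z)\<^sup>2) \<partial>\<mu>) < \<infinity>"
proof -
  note [measurable_cong] = sets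
  have [measurable]: "(\<lambda>x. dist x z) \<in> borel_measurable borel"
    by (intro borel_measurable_continuous_onI continuous_intros)
  have "(\<integral>\<^sup>+x. ennreal ((dist x z)\<^sup>2) \<partial>\<mu>)
      \<le> (\<integral>\<^sup>+x. ennreal (1 / \<epsilon>) * ennreal (exp (\<epsilon> * (dist x z)\<^sup>2)) \<partial>\<mu>)"
  proof (intro nn_integral_mono)
    fix x
    have "\<epsilon> * (dist x z)\<^sup>2 \<le> exp (\<epsilon> * (dist x z)\<^sup>2)"
      using exp_ge_add_one_self[of "\<epsilon> * (dist x z)\<^sup>2"] by linarith
    then have "(dist x z)\<^sup>2 \<le> 1 / \<epsilon> * exp (\<epsilon> * (dist x z)\<^sup>2)"
      using \<open>\<epsilon> > 0\<close> by (simp add: field_simps)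
    then show "ennreal ((dist x z)\<^sup>2) \<le> ennreal (1 / \<epsilon>) * ennreal (exp (\<epsilon> * (dist x z)\<^sup>2))"
      using \<open>\<epsilon> > 0\<close> by (simp add: ennreal_mult'[symmetric])
  qed
  also have "\<dots> = ennreal (1 / \<epsilon>) * (\<integral>\<^sup>+x. ennreal (exp (\<epsilon> * (dist x z)\<^sup>2)) \<partial>\<mu>)"
    by (rule nn_integral_cmult) measurable
  also have "\<dots> < \<infinity>"
    using fin by (simp add: ennreal_mult_less_top)
  finally show ?thesis .
qed

text \<open>The coupling cost is summed up with constants that depend on \<open>a\<close>, \<open>D\<close> and the second moment
  \<open>m\<close> of \<open>\<mu>\<close>, but not on \<open>h\<close>. Here \<open>p\<^sub>0\<close> is the lower bound for \<open>\<nu>(h \<le> a)\<close> that results from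
  entropy at most \<open>1/2\<close>, and it is positive exactly because \<open>ln a - 1 > 1/2\<close>.\<close>

lemma Tronc_if_Var_Ent:
  fixes \<mu> :: "'a::polish_space measure"
  assumes "prob_space \<mu>" and sets: "sets \<mu> = sets borel"
    and moment: "(\<integral>\<^sup>+x. ennreal ((dist x z)\<^sup>2) \<partial>\<mu>) < \<infinity>"
    and a: "a > exp (3 / 2)" and "Var_Ent \<mu> z a"
  shows "Tronc \<mu> a"
proof -
  have space: "space \<mu> = UNIV"
    using sets_eq_imp_space_eq[OF sets] by simp
  have "a > 0"
    using a by (rule less_trans[OF exp_gt_zero])
  with a have ln_a: "ln a > 3 / 2"
    using ln_less_cancel_iff[of "exp (3 / 2)" a] by simp
  obtain m where m: "(\<integral>\<^sup>+x. ennreal ((dist x z)\<^sup>2) \<partial>\<mu>) = ennreal m" "m \<ge> 0"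
    using moment by (cases "\<integral>\<^sup>+x. ennreal ((dist x z)\<^sup>2) \<partial>\<mu>") auto
  obtain D where D: "\<And>h. \<lbrakk>prob_density \<mu> h; rel_entropy (with_density \<mu> h) \<mu> \<le> 1/2\<rbrakk> \<Longrightarrow>
      enn2ereal (\<integral>\<^sup>+x. ennreal ((dist x z)\<^sup>2) * indicator {x. h x > a} x \<partial>with_density \<mu> h)
        \<le> ereal D * rel_entropy (with_density \<mu> h) \<mu>"
    using \<open>Var_Ent \<mu> z a\<close> unfolding Var_Ent_def by blast
  define k where "k = ln a - 1"
  have k: "k > 1 / 2"
    using ln_a by (simp add: k_def)
  define p\<^sub>0 where "p\<^sub>0 = 1 - 1 / (2 * k)"
  have p\<^sub>0: "p\<^sub>0 > 0"
    using k by (simp add: p\<^sub>0_def field_simps)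
  \<comment> \<open>(Var-Ent) admits a negative \<open>D\<close>; the absolute value keeps all terms in the extended
    nonnegative reals.\<close>
  define c where "c = 2 * (a * m / (k * p\<^sub>0)) + 2 * \<bar>D\<bar>"
  show ?thesis
    unfolding Tronc_def
  proof (intro exI allI impI, elim conjE)
    fix h
    assume dens: "prob_density \<mu> h" and half: "rel_entropy (with_density \<mu> h) \<mu> \<le> 1/2"
    have [measurable]: "h \<in> borel_measurable \<mu>" and "prob_space (with_density \<mu> h)"
      using dens by (auto simp: prob_density_def)
    let ?\<nu> = "with_density \<mu> h"
    let ?A = "{x \<in> space \<mu>. h x \<le> a}"
    interpret \<nu>: prob_space ?\<nu> by fact
    have sets_\<nu>: "sets ?\<nu> = sets \<mu>"
      by (simp add: with_density_def)
    have compl: "- ?A = {x \<in> space \<mu>. h x > a}"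
      by (auto simp: space)
    define q where "q = measure ?\<nu> (- ?A)"
    have q: "0 \<le> q" by (simp add: q_def)
    have ent: "ereal (k * q) \<le> rel_entropy ?\<nu> \<mu>"
      unfolding k_def q_def compl using ln_a \<open>a > 0\<close> dens assms(1)
      by (intro rel_entropy_tail) auto
    have half': "rel_entropy ?\<nu> \<mu> \<le> ereal (1/2)"
      using half by (simp add: one_ereal_def numeral_eq_ereal)
    \<comment> \<open>A difference of extended reals could be \<open>-\<infinity>\<close>; the tail bound excludes it.\<close>
    obtain r where r: "rel_entropy ?\<nu> \<mu> = ereal r"
      using ent half' by (cases "rel_entropy ?\<nu> \<mu>") auto
    have kq: "k * q \<le> r" and r_half: "r \<le> 1/2"
      using ent half' by (simp_all add: r)
    have "0 \<le> r"
      using kq k q by (meson order_trans mult_nonneg_nonneg less_imp_le half_gt_zero_iff zero_less_one less_trans)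
    have q_le: "q \<le> r / k"
      using kq k by (simp add: field_simps)
    also have "\<dots> \<le> 1 / (2 * k)"
      using r_half k by (simp add: field_simps)
    finally have "q \<le> 1 - p\<^sub>0"
      by (simp add: p\<^sub>0_def)
    moreover have "measure ?\<nu> ?A = 1 - q"
    proof -
      have "?A \<in> sets ?\<nu>"
        unfolding sets_\<nu> by measurable
      from \<nu>.prob_compl[OF this] show ?thesis
        by (simp add: q_def with_density_def space Compl_eq_Diff_UNIV)
    qed
    ultimately have p: "measure ?\<nu> ?A \<ge> p\<^sub>0"
      by simp
    have trunc: "truncated \<mu> h a = uniform_measure ?\<nu> ?A"
      using p p\<^sub>0 by (intro truncated_eq_uniform_measure dens) auto
    let ?T = "\<integral>\<^sup>+x. ennreal ((dist x z)\<^sup>2) * indicator (- ?A) x \<partial>?\<nu>"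
    have "(W2 (truncated \<mu> h a) ?\<nu>)\<^sup>2
        \<le> 2 * (emeasure ?\<nu> (- ?A) * (\<integral>\<^sup>+x. ennreal ((dist x z)\<^sup>2) \<partial>truncated \<mu> h a)) + 2 * ?T"
      unfolding trunc using p p\<^sub>0
      by (intro W2_uniform_measure_le \<nu>.prob_space_axioms)
        (auto simp: sets_\<nu> sets \<nu>.emeasure_eq_measure simp flip: sets)
    also have "\<dots> \<le> 2 * (ennreal (r / k) * ennreal (a / p\<^sub>0 * m)) + 2 * ennreal (\<bar>D\<bar> * r)"
    proof (intro add_mono mult_mono order_refl)
      show "emeasure ?\<nu> (- ?A) \<le> ennreal (r / k)"
        using q_le by (simp add: \<nu>.emeasure_eq_measure q_def ennreal_leI)
      have "a / measure ?\<nu> ?A \<le> a / p\<^sub>0"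
        using p p\<^sub>0 \<open>a > 0\<close> by (intro divide_left_mono) auto
      then have "ennreal (a / measure ?\<nu> ?A) * ennreal m \<le> ennreal (a / p\<^sub>0 * m)"
        using m \<open>a > 0\<close> by (simp add: ennreal_mult''[symmetric] ennreal_leI mult_right_mono del: times_divide_eq_left)
      with second_moment_truncated_le[OF sets dens, of a z]
      show "(\<integral>\<^sup>+x. ennreal ((dist x z)\<^sup>2) \<partial>truncated \<mu> h a) \<le> ennreal (a / p\<^sub>0 * m)"
        using \<open>a > 0\<close> m by (auto intro: order_trans)
      have "enn2ereal ?T \<le> ereal (D * r)"
        using D[OF dens half] compl by (simp add: r space)
      also have "\<dots> \<le> ereal (\<bar>D\<bar> * r)"
        using \<open>0 \<le> r\<close> by (simp add: mult_right_mono)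
      finally show "?T \<le> ennreal (\<bar>D\<bar> * r)"
        using \<open>0 \<le> r\<close> by (cases ?T) (auto simp: enn2ereal_ennreal intro: ennreal_leI)
    qed auto
    also have "\<dots> = ennreal (2 * (r / k * (a / p\<^sub>0 * m)) + 2 * (\<bar>D\<bar> * r))"
    proof -
      have "0 \<le> r / k" "0 \<le> a / p\<^sub>0 * m" "0 \<le> \<bar>D\<bar> * r"
        using k p\<^sub>0 m \<open>a > 0\<close> \<open>0 \<le> r\<close> by simp_all
      then show ?thesis
        by (simp add: ennreal_mult del: times_divide_eq_left times_divide_eq_right)
    qed
    also have "2 * (r / k * (a / p\<^sub>0 * m)) + 2 * (\<bar>D\<bar> * r) = c * r"
      by (simp add: c_def algebra_simps)
    finally have "(W2 (truncated \<mu> h a) ?\<nu>)\<^sup>2 \<le> ennreal (c * r)" .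
    moreover have "0 \<le> c * r"
      using k p\<^sub>0 m \<open>a > 0\<close> \<open>0 \<le> r\<close> by (simp add: c_def)
    ultimately show "enn2ereal ((W2 (truncated \<mu> h a) ?\<nu>)\<^sup>2) \<le> ereal c * rel_entropy ?\<nu> \<mu>"
      by (simp add: r) (metis enn2ereal_ennreal less_eq_ennreal.rep_eq)
  qed
qed

theorem mainTheorem4:
  fixes charts :: "('a::polish_space, 'n::finite) chart set"
    and g :: "('a, 'n) chart \<Rightarrow> 'a \<Rightarrow> real^'n^'n"
    and vol \<mu> :: "'a measure"
    and V :: "'a \<Rightarrow> real"
    and x\<^sub>0 :: 'a
    and \<epsilon> a :: real
  assumes "complete_riemannian_manifold charts g"
    and "riemannian_volume charts g vol"
    and "Ck_function charts 3 V"
    and "\<mu> = density vol (\<lambda>x. ennreal (exp (- V x)))"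
    and "prob_space \<mu>"
    and "non_explosive charts (generator charts g V)"
    and "\<epsilon> > 0"
    and "(\<integral>\<^sup>+x. ennreal (exp (\<epsilon> * (dist x x\<^sub>0)\<^sup>2)) \<partial>\<mu>) < \<infinity>"
    and "a > exp (3 / 2)"
    and "Var_Ent \<mu> x\<^sub>0 a"
  shows "Tronc \<mu> a"
proof -
  have "sets \<mu> = sets borel"
    using assms(2,4) by (simp add: riemannian_volume_def)
  with assms(5,7-10) show ?thesis
    by (intro Tronc_if_Var_Ent second_moment_finite)
qed

end
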